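(* Let $c,\phi\in\mathbb{R}$ with $\phi\neq0$, and let $H(s)$ be a continuous function on an interval in $(0,\infty)$ containing $s_0$. Then there exists a 2-parameter family of helicoidal surfaces of i-type in $\mathbb{I}^3$ with $H$ as the mean curvature (i.e. the mean curvature at the point with parameters $(s,t)$ is $H(s)$) and whose generating curves $\alpha_{h_0,h_1}(s)=(s,0,z(s))$, $s>0$ arc-length parameter, satisfy $$z(s)=h_0+h_1\ln s+\int_{s_0}^{s}\left(\frac{2}{v}\int_{s_0}^{v}w\,H(w)\,dw\right)dv,$$ where $h_0,h_1$ are constants depending on the values of $z,z'$ at $s=s_0$.
   Context: The simply isotropic space $\mathbb{I}^3$ is $\mathbb{R}^3$ with the degenerate metric $\langle u,v\rangle_z=u^1v^1+u^2v^2$. For a $C^2$ parameterized surface $\mathbf{x}(u^1,u^2)=(x^1,x^2,x^3)$ write $\mathbf{x}_i=\partial\mathbf{x}/\partial u^i$, $\mathbf{x}_{ij}=\partial^2\mathbf{x}/\partial u^i\partial u^j$, $x^i_k=\partial x^i/\partial u^k$, $X_{ij}=x^i_1x^j_2-x^j_1x^i_2$. The surface is admissible if $X_{12}\neq0$ (equivalently, the induced metric has rank 2). Put $g_{ij}=\langle\mathbf{x}_i,\mathbf{x}_j\rangle_z$, $N_h=\left(\frac{X_{23}}{X_{12}},\frac{X_{31}}{X_{12}},1\right)$, $h_{ij}=\langle N_h,\mathbf{x}_{ij}\rangle$ (Euclidean inner product). The Gaussian and mean curvatures are $$K=\frac{h_{11}h_{22}-h_{12}^2}{g_{11}g_{22}-g_{12}^2},\qquad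 H=\frac12\,\frac{g_{11}h_{22}-2g_{12}h_{12}+g_{22}h_{11}}{g_{11}g_{22}-g_{12}^2};$$ equivalently $K=\det L$, $H=\frac12\mathrm{tr}\,L$ with $L=-D\xi$, $\xi=\left(A,B,\frac12(1-A^2-B^2)\right)$, $A=X_{23}/X_{12}$, $B=X_{31}/X_{12}$. The helicoidal surface of i-type with generating curve $\alpha(u)=(x(u),0,z(u))$ (a $C^2$ curve) and parameters $c,\phi$ is $$Z_2(u,t)=(x(u)\cos(t\phi),\ x(u)\sin(t\phi),\ z(u)+ct),$$ with coordinates $(u^1,u^2)=(u,t)$. Surfaces are assumed admissible, which here means $\phi\,x\,x'\neq0$. *)

theory Defs
  imports "HOL-Analysis.Analysis"
begin

text \<open>
  Simply isotropic geometry of parameterized surfaces \<open>x : D \<subseteq> \<real>\<^sup>2 \<rightarrow> \<real>\<^sup>3\<close>.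
  The parameters \<open>(u\<^sup>1, u\<^sup>2)\<close> are the components \<open>u $ 1\<close>, \<open>u $ 2\<close> of \<open>u :: real^2\<close>.
\<close>

definition iso_inner :: "real^3 \<Rightarrow> real^3 \<Rightarrow> real" where
  "iso_inner u v = u $ 1 * v $ 1 + u $ 2 * v $ 2"

text \<open>
  Partial derivatives are taken within \<open>D\<close>, so they are the usual ones at interior points and
  one-sided where the \<open>k\<close>-th coordinate line ends at a boundary point of \<open>D\<close>. They are meaningful
  only if \<open>0\<close> is a limit point of the slice used below.
\<close>

definition slice :: "(real^2) set \<Rightarrow> real^2 \<Rightarrow> 2 \<Rightarrow> real set" where
  "slice D u k = {r. u + r *\<^sub>R axis k 1 \<in> D}"

definition pderiv_on :: "(real^2) set \<Rightarrow> 2 \<Rightarrow> (real^2 \<Rightarrow> real^3) \<Rightarrow> real^2 \<Rightarrow> real^3" where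
  "pderiv_on D k x u =
     vector_derivative (\<lambda>r. x (u + r *\<^sub>R axis k 1)) (at 0 within slice D u k)"

definition C1_surface_on :: "(real^2) set \<Rightarrow> (real^2 \<Rightarrow> real^3) \<Rightarrow> bool" where
  "C1_surface_on D x \<longleftrightarrow> continuous_on D x \<and>
     (\<forall>k. (\<forall>u\<in>D. (\<lambda>r. x (u + r *\<^sub>R axis k 1)) differentiable (at 0 within slice D u k)) \<and>
          continuous_on D (pderiv_on D k x))"

definition C2_surface_on :: "(real^2) set \<Rightarrow> (real^2 \<Rightarrow> real^3) \<Rightarrow> bool" where
  "C2_surface_on D x \<longleftrightarrow> C1_surface_on D x \<and> (\<forall>k. C1_surface_on D (pderiv_on D k x))"

text \<open>The minors \<open>X\<^sub>i\<^sub>j = x\<^sup>i\<^sub>1 x\<^sup>j\<^sub>2 - x\<^sup>j\<^sub>1 x\<^sup>i\<^sub>2\<close> of the Jacobian matrix.\<close>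

definition minorX :: "(real^2) set \<Rightarrow> (real^2 \<Rightarrow> real^3) \<Rightarrow> 3 \<Rightarrow> 3 \<Rightarrow> real^2 \<Rightarrow> real" where
  "minorX D x i j u = pderiv_on D 1 x u $ i * pderiv_on D 2 x u $ j
                    - pderiv_on D 1 x u $ j * pderiv_on D 2 x u $ i"

definition admissible_surface :: "(real^2) set \<Rightarrow> (real^2 \<Rightarrow> real^3) \<Rightarrow> bool" where
  "admissible_surface D x \<longleftrightarrow> C2_surface_on D x \<and> (\<forall>u\<in>D. minorX D x 1 2 u \<noteq> 0)"

definition fundI :: "(real^2) set \<Rightarrow> (real^2 \<Rightarrow> real^3) \<Rightarrow> 2 \<Rightarrow> 2 \<Rightarrow> real^2 \<Rightarrow> real" where
  "fundI D x i j u = iso_inner (pderiv_on D i x u) (pderiv_on D j x u)"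

definition minimal_normal :: "(real^2) set \<Rightarrow> (real^2 \<Rightarrow> real^3) \<Rightarrow> real^2 \<Rightarrow> real^3" where
  "minimal_normal D x u =
     vector [minorX D x 2 3 u / minorX D x 1 2 u, minorX D x 3 1 u / minorX D x 1 2 u, 1]"

definition fundII :: "(real^2) set \<Rightarrow> (real^2 \<Rightarrow> real^3) \<Rightarrow> 2 \<Rightarrow> 2 \<Rightarrow> real^2 \<Rightarrow> real" where
  "fundII D x i j u = minimal_normal D x u \<bullet> pderiv_on D i (pderiv_on D j x) u"

definition mean_curvature :: "(real^2) set \<Rightarrow> (real^2 \<Rightarrow> real^3) \<Rightarrow> real^2 \<Rightarrow> real" where
  "mean_curvature D x u =
     (1 / 2) * ((fundI D x 1 1 u * fundII D x 2 2 u - 2 * fundI D x 1 2 u * fundII D x 1 2 u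
                 + fundI D x 2 2 u * fundII D x 1 1 u)
              / (fundI D x 1 1 u * fundI D x 2 2 u - (fundI D x 1 2 u)\<^sup>2))"

definition generating_curve :: "(real \<Rightarrow> real) \<Rightarrow> (real \<Rightarrow> real) \<Rightarrow> real \<Rightarrow> real^3" where
  "generating_curve x z s = vector [x s, 0, z s]"

definition C2_curve_on :: "real set \<Rightarrow> (real \<Rightarrow> real^3) \<Rightarrow> bool" where
  "C2_curve_on I \<alpha> \<longleftrightarrow> (\<exists>\<alpha>' \<alpha>''.
     (\<forall>s\<in>I. (\<alpha> has_vector_derivative \<alpha>' s) (at s within I)) \<and>
     (\<forall>s\<in>I. (\<alpha>' has_vector_derivative \<alpha>'' s) (at s within I)) \<and> continuous_on I \<alpha>'')"

text \<open>Arc length with respect to the degenerate isotropic metric.\<close>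

definition iso_arclength_on :: "real set \<Rightarrow> (real \<Rightarrow> real^3) \<Rightarrow> bool" where
  "iso_arclength_on I \<alpha> \<longleftrightarrow>
     (\<forall>s\<in>I. iso_inner (vector_derivative \<alpha> (at s within I)) (vector_derivative \<alpha> (at s within I)) = 1)"

text \<open>The helicoidal surface of i-type, to be considered on the strip \<open>I \<times> \<real>\<close>.\<close>

definition helicoidal_i ::
    "real \<Rightarrow> real \<Rightarrow> (real \<Rightarrow> real) \<Rightarrow> (real \<Rightarrow> real) \<Rightarrow> real^2 \<Rightarrow> real^3" where
  "helicoidal_i c \<phi> x z u =
     vector [x (u $ 1) * cos (u $ 2 * \<phi>), x (u $ 1) * sin (u $ 2 * \<phi>), z (u $ 1) + c * u $ 2]"

definition strip :: "real set \<Rightarrow> (real^2) set" where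
  "strip I = {u. u $ 1 \<in> I}"

end

theory Submission
  imports Defs
begin

text \<open>
  For \<open>Z(s,t) = (s cos(t\<phi>), s sin(t\<phi>), z(s) + ct)\<close> the isotropic first fundamental form is
  \<open>diag(1, \<phi>\<^sup>2s\<^sup>2)\<close>, whatever \<open>z\<close> and \<open>c\<close> are, because the metric ignores the third coordinate.
  Hence \<open>h\<^sub>1\<^sub>2\<close> does not enter the mean curvature; since \<open>h\<^sub>1\<^sub>1 = z''\<close> and \<open>h\<^sub>2\<^sub>2 = \<phi>\<^sup>2 s z'\<close>, the equation
  \<open>2H = z'' + z'/s\<close> results (lemma \<open>mean_curvature_helicoidal_i\<close>). In the form \<open>(s z')' = 2 s H\<close>
  it is solved by two integrations: \<open>s z' = h\<^sub>1 + 2 \<integral> w H(w) dw\<close>, then \<open>z\<close> itself. Both integrals start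
  at \<open>s\<^sub>0\<close>, so they vanish there, which identifies \<open>h\<^sub>1 = s\<^sub>0 z'(s\<^sub>0)\<close> and \<open>h\<^sub>0 = z(s\<^sub>0) - h\<^sub>1 ln s\<^sub>0\<close>.

  Two points need care. The interval may contain some of its endpoints, so all derivatives are taken
  within it; the fundamental theorem of calculus is localised accordingly
  (\<open>interval_integral_has_derivative_within\<close>). And second order smoothness of \<open>Z\<close> needs partial
  derivatives of partial derivatives; these are all handled at once by a class of maps that contains
  \<open>Z\<close> and is closed under both partial derivatives (\<open>helical_field\<close>).
\<close>

section \<open>Integration over intervals that need not be closed\<close>

text \<open>
  A one-sided neighbourhood of \<open>s\<close> in the interval matters only up to points \<open>a\<close>, \<open>b\<close> beyond \<open>s\<close>, or
  up to \<open>s\<close> itself if \<open>s\<close> is an endpoint; enlarging \<open>{a..b}\<close> to reach the base point \<open>s0\<close> is harmless.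
\<close>

lemma interval_locally_compact_at:
  fixes I :: "real set"
  assumes "is_interval I" "s \<in> I" "s0 \<in> I"
  obtains a b where "{a..b} \<subseteq> I" "s \<in> {a..b}" "s0 \<in> {a..b}" "at s within I = at s within {a..b}"
proof -
  obtain b where b: "b \<in> I" "s \<le> b" "s0 \<le> b" "s < b \<or> (\<forall>y\<in>I. y \<le> s)"
  proof (cases "\<exists>y\<in>I. s < y")
    case True
    then obtain y where "y \<in> I" "s < y" by blast
    then show thesis using that[of "max y s0"] assms by (auto simp: max_def)
  next
    case False
    then show thesis using that[of s] assms by (auto simp: not_less)
  qed
  obtain a where a: "a \<in> I" "a \<le> s" "a \<le> s0" "a < s \<or> (\<forall>y\<in>I. s \<le> y)"
  proof (cases "\<exists>y\<in>I. y < s")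
    case True
    then obtain y where "y \<in> I" "y < s" by blast
    then show thesis using that[of "min y s0"] assms by (auto simp: min_def)
  next
    case False
    then show thesis using that[of s] assms by (auto simp: not_less)
  qed
  have sub: "{a..b} \<subseteq> I"
    using mem_is_interval_1_I[OF assms(1) a(1) b(1)] by auto
  define U where "U = (if a < s then {a<..} else UNIV) \<inter> (if s < b then {..<b} else UNIV)"
  have "open U" "s \<in> U" by (auto simp: U_def)
  moreover have "y \<in> {a..b}" if "y \<in> I" "y \<in> U" for y
  proof -
    have "a \<le> y" using a that by (cases "a < s") (auto simp: U_def)
    moreover have "y \<le> b" using b that by (cases "s < b") (auto simp: U_def)
    ultimately show ?thesis by simp
  qed
  then have "I \<inter> U - {s} = {a..b} \<inter> U - {s}"
    using sub by blast
  ultimately have "at s within I = at s within {a..b}"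
    by (intro at_within_nhd[of s U]) auto
  then show thesis using that[of a b] sub a b by auto
qed

lemma interval_integral_has_derivative_within:
  fixes f :: "real \<Rightarrow> real"
  assumes "is_interval I" "s0 \<in> I" "continuous_on I f" "s \<in> I"
  shows "((\<lambda>u. LBINT y=ereal s0..ereal u. f y) has_real_derivative f s) (at s within I)"
proof -
  obtain a b where ab: "{a..b} \<subseteq> I" "s \<in> {a..b}" "s0 \<in> {a..b}"
      and at: "at s within I = at s within {a..b}"
    using interval_locally_compact_at[OF assms(1,4,2)] .
  have "((\<lambda>u. LBINT y=ereal s0..ereal u. f y) has_vector_derivative f s) (at s within {a..b})"
    using ab by (intro interval_integral_FTC2 continuous_on_subset[OF assms(3)]) auto
  then show ?thesis
    by (simp add: at has_real_derivative_iff_has_vector_derivative)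
qed

lemma interval_limit_point:
  fixes I :: "real set"
  assumes "is_interval I" "interior I \<noteq> {}" "s \<in> I"
  shows "s islimpt I"
proof -
  have "I \<noteq> {s}" using assms(2) by auto
  then show ?thesis
    using assms by (intro connected_imp_perfect) (auto simp: is_interval_connected_1)
qed

section \<open>Vectors with three components\<close>

lemma vector_3_scaleR:
  "(vector [a, b, c] :: real^3) = a *\<^sub>R axis 1 1 + b *\<^sub>R axis 2 1 + c *\<^sub>R axis 3 1"
  by (simp add: vec_eq_iff forall_3 axis_def)

lemma has_vector_derivative_vector_3:
  assumes "(f has_real_derivative f') (at x within S)" "(g has_real_derivative g') (at x within S)"
    "(h has_real_derivative h') (at x within S)"
  shows "((\<lambda>s. vector [f s, g s, h s] :: real^3) has_vector_derivative vector [f', g', h'])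
    (at x within S)"
proof -
  have scale: "((\<lambda>s. k s *\<^sub>R e) has_vector_derivative k' *\<^sub>R e) (at x within S)"
    if "(k has_real_derivative k') (at x within S)" for k k' and e :: "real^3"
    using has_vector_derivative_scaleR[OF that has_vector_derivative_const[of e]] by simp
  show ?thesis
    unfolding vector_3_scaleR by (intro has_vector_derivative_add scale assms)
qed

lemma continuous_on_vector_3:
  fixes f g h :: "'a::topological_space \<Rightarrow> real"
  assumes "continuous_on S f" "continuous_on S g" "continuous_on S h"
  shows "continuous_on S (\<lambda>s. vector [f s, g s, h s] :: real^3)"
  unfolding vector_3_scaleR using assms by (intro continuous_intros)

section \<open>Partial derivatives of helical fields\<close>

text \<open>
  The planar part is the plane vector \<open>(p, q)\<close> rotated by the angle \<open>t\<phi>\<close>. Differentiation in \<open>s\<close> acts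
  on the coefficients, and differentiation in \<open>t\<close> rotates \<open>(p, q)\<close> by a right angle and scales it by
  \<open>\<phi>\<close>. So all iterated partial derivatives of a helicoidal surface are again of this form.
\<close>

definition helical_field ::
    "real \<Rightarrow> (real \<Rightarrow> real) \<Rightarrow> (real \<Rightarrow> real) \<Rightarrow> (real \<Rightarrow> real) \<Rightarrow> real \<Rightarrow> real^2 \<Rightarrow> real^3" where
  "helical_field \<phi> p q r k u =
     vector [p (u $ 1) * cos (u $ 2 * \<phi>) - q (u $ 1) * sin (u $ 2 * \<phi>),
             p (u $ 1) * sin (u $ 2 * \<phi>) + q (u $ 1) * cos (u $ 2 * \<phi>),
             r (u $ 1) + k * u $ 2]"

lemma helicoidal_i_helical_field:
  "helicoidal_i c \<phi> x z = helical_field \<phi> x (\<lambda>_. 0) z c"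
  by (simp add: fun_eq_iff helicoidal_i_def helical_field_def)

lemma continuous_on_helical_field:
  assumes "continuous_on I p" "continuous_on I q" "continuous_on I r"
  shows "continuous_on (strip I) (helical_field \<phi> p q r k)"
proof -
  have comp: "continuous_on (strip I) (\<lambda>u. f (u $ 1))" if "continuous_on I f" for f :: "real \<Rightarrow> real"
    using that by (rule continuous_on_compose2) (auto simp: strip_def intro!: continuous_intros)
  show ?thesis
    unfolding helical_field_def
    by (intro continuous_on_vector_3 continuous_intros comp assms)
qed

lemma slice_strip:
  "slice (strip I) u 1 = {r. u $ 1 + r \<in> I}" "u \<in> strip I \<Longrightarrow> slice (strip I) u 2 = UNIV"
  by (auto simp: slice_def strip_def axis_def)

lemma slice_strip_limit_point:
  assumes "\<And>s. s \<in> I \<Longrightarrow> s islimpt I" "u \<in> strip I"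
  shows "at 0 within slice (strip I) u k \<noteq> bot"
proof -
  consider "k = 1" | "k = 2" using exhaust_2 by blast
  then show ?thesis
  proof cases
    case 1
    have "u $ 1 islimpt I" using assms by (auto simp: strip_def)
    have "\<exists>r. u $ 1 + r \<in> I \<and> r \<noteq> 0 \<and> dist r 0 < e" if "e > 0" for e
    proof -
      obtain y where "y \<in> I" "y \<noteq> u $ 1" "dist y (u $ 1) < e"
        using \<open>u $ 1 islimpt I\<close> \<open>e > 0\<close> by (auto simp: islimpt_approachable)
      then show ?thesis by (intro exI[of _ "y - u $ 1"]) (simp add: dist_real_def)
    qed
    then have "0 islimpt {r. u $ 1 + r \<in> I}"
      by (auto simp: islimpt_approachable)
    then show ?thesis using 1 by (simp add: slice_strip trivial_limit_within)
  next
    case 2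
    then show ?thesis using assms by (simp add: slice_strip)
  qed
qed

lemma helical_field_derivative_1:
  assumes "u \<in> strip I"
    and p: "(p has_real_derivative p' (u $ 1)) (at (u $ 1) within I)"
    and q: "(q has_real_derivative q' (u $ 1)) (at (u $ 1) within I)"
    and r: "(r has_real_derivative r' (u $ 1)) (at (u $ 1) within I)"
  shows "((\<lambda>\<rho>. helical_field \<phi> p q r k (u + \<rho> *\<^sub>R axis 1 1)) has_vector_derivative
           helical_field \<phi> p' q' r' 0 u) (at 0 within slice (strip I) u 1)"
proof -
  have shift: "((\<lambda>\<rho>. f (u $ 1 + \<rho>)) has_real_derivative f') (at 0 within slice (strip I) u 1)"
    if "(f has_real_derivative f') (at (u $ 1) within I)" for f f'
  proof -
    have "(f has_real_derivative f') (at (u $ 1 + 0) within (\<lambda>\<rho>. u $ 1 + \<rho>) ` slice (strip I) u 1)"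
      using that by (auto simp: slice_strip intro: DERIV_subset)
    moreover have "((\<lambda>\<rho>. u $ 1 + \<rho>) has_real_derivative 1) (at 0 within slice (strip I) u 1)"
      by (auto intro!: derivative_eq_intros)
    ultimately show ?thesis
      using DERIV_image_chain[of f f' "\<lambda>\<rho>. u $ 1 + \<rho>" 0 "slice (strip I) u 1" 1]
      by (simp add: o_def)
  qed
  have axis: "(u + \<rho> *\<^sub>R axis 1 1) $ 1 = u $ 1 + \<rho>" "(u + \<rho> *\<^sub>R axis 1 1) $ 2 = u $ 2" for \<rho>
    by (simp_all add: axis_def)
  show ?thesis
    unfolding helical_field_def axis
    using shift[OF r]
    by (intro has_vector_derivative_vector_3 DERIV_add DERIV_diff DERIV_cmult_right
        shift[OF p] shift[OF q]) (auto intro: DERIV_add[OF _ DERIV_const, THEN DERIV_cong])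
qed

lemma helical_field_derivative_2:
  "((\<lambda>\<rho>. helical_field \<phi> p q r k (u + \<rho> *\<^sub>R axis 2 1)) has_vector_derivative
     helical_field \<phi> (\<lambda>s. - \<phi> * q s) (\<lambda>s. \<phi> * p s) (\<lambda>_. k) 0 u) (at 0 within S)"
proof -
  have axis: "(u + \<rho> *\<^sub>R axis 2 1) $ 1 = u $ 1" "(u + \<rho> *\<^sub>R axis 2 1) $ 2 = u $ 2 + \<rho>" for \<rho>
    by (simp_all add: axis_def)
  show ?thesis
    unfolding helical_field_def axis
    by (intro has_vector_derivative_vector_3)
      (auto intro!: derivative_eq_intros simp: algebra_simps)
qed

text \<open>
  The map \<open>X\<close> is only required to agree with a helical field on the strip, so that the lemma applies to
  partial derivatives, whose values off their domain carry no information.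
\<close>

lemma helical_field_partials:
  assumes perfect: "\<And>s. s \<in> I \<Longrightarrow> s islimpt I"
    and p: "\<And>s. s \<in> I \<Longrightarrow> (p has_real_derivative p' s) (at s within I)"
    and q: "\<And>s. s \<in> I \<Longrightarrow> (q has_real_derivative q' s) (at s within I)"
    and r: "\<And>s. s \<in> I \<Longrightarrow> (r has_real_derivative r' s) (at s within I)"
    and cont: "continuous_on I p'" "continuous_on I q'" "continuous_on I r'"
    and X: "\<And>u. u \<in> strip I \<Longrightarrow> X u = helical_field \<phi> p q r k u"
  shows "C1_surface_on (strip I) X"
    and "\<And>u. u \<in> strip I \<Longrightarrow> pderiv_on (strip I) 1 X u = helical_field \<phi> p' q' r' 0 u"
    and "\<And>u. u \<in> strip I \<Longrightarrow>
           pderiv_on (strip I) 2 X u = helical_field \<phi> (\<lambda>s. - \<phi> * q s) (\<lambda>s. \<phi> * p s) (\<lambda>_. k) 0 u"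
proof -
  let ?D = "strip I"
  define d where "d j = (if j = 1 then helical_field \<phi> p' q' r' 0
      else helical_field \<phi> (\<lambda>s. - \<phi> * q s) (\<lambda>s. \<phi> * p s) (\<lambda>_. k) 0)" for j :: 2
  have contp: "continuous_on I p" "continuous_on I q" "continuous_on I r"
    by (auto intro!: DERIV_continuous_on p q r)
  have contd: "continuous_on ?D (d j)" for j
    by (auto simp: d_def intro!: continuous_on_helical_field continuous_intros contp cont)
  have deriv: "((\<lambda>\<rho>. X (u + \<rho> *\<^sub>R axis j 1)) has_vector_derivative d j u)
      (at 0 within slice ?D u j)" if u: "u \<in> ?D" for u j
  proof -
    have u1: "u $ 1 \<in> I" using u by (simp add: strip_def)
    have "((\<lambda>\<rho>. helical_field \<phi> p q r k (u + \<rho> *\<^sub>R axis j 1)) has_vector_derivative d j u)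
        (at 0 within slice ?D u j)"
      using helical_field_derivative_1[where p' = p' and q' = q' and r' = r',
          OF u p[OF u1] q[OF u1] r[OF u1]] helical_field_derivative_2 exhaust_2[of j]
      by (auto simp: d_def)
    then show ?thesis
      by (rule has_vector_derivative_transform[rotated 2]) (use u in \<open>auto simp: slice_def X\<close>)
  qed
  have pd: "pderiv_on ?D j X u = d j u" if "u \<in> ?D" for u j
    unfolding pderiv_on_def
    using vector_derivative_within[OF slice_strip_limit_point[OF perfect that] deriv[OF that]] .
  show "C1_surface_on ?D X"
    unfolding C1_surface_on_def
  proof (intro conjI allI ballI)
    show "continuous_on ?D X"
      using continuous_on_helical_field[OF contp] X by (simp cong: continuous_on_cong)
    show "(\<lambda>\<rho>. X (u + \<rho> *\<^sub>R axis j 1)) differentiable (at 0 within slice ?D u j)"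
      if "u \<in> ?D" for u j
      using deriv[OF that] by (rule differentiableI_vector)
    show "continuous_on ?D (pderiv_on ?D j X)" for j
      using contd pd by (simp cong: continuous_on_cong)
  qed
  show "pderiv_on ?D 1 X u = helical_field \<phi> p' q' r' 0 u" if "u \<in> ?D" for u
    using pd[OF that, of 1] by (simp add: d_def)
  show "pderiv_on ?D 2 X u = helical_field \<phi> (\<lambda>s. - \<phi> * q s) (\<lambda>s. \<phi> * p s) (\<lambda>_. k) 0 u"
    if "u \<in> ?D" for u
    using pd[OF that, of 2] by (simp add: d_def)
qed

section \<open>Curvature of helicoidal surfaces\<close>

context
  fixes I :: "real set" and c \<phi> :: real and z z' z'' :: "real \<Rightarrow> real"
  assumes perfect: "\<And>s. s \<in> I \<Longrightarrow> s islimpt I"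
    and positive: "I \<subseteq> {0<..}"
    and rotation: "\<phi> \<noteq> 0"
    and z: "\<And>s. s \<in> I \<Longrightarrow> (z has_real_derivative z' s) (at s within I)"
    and z': "\<And>s. s \<in> I \<Longrightarrow> (z' has_real_derivative z'' s) (at s within I)"
    and z'': "continuous_on I z''"
begin

private abbreviation (input) "Z \<equiv> helicoidal_i c \<phi> (\<lambda>s. s) z"

private lemma z'_continuous: "continuous_on I z'"
  by (rule DERIV_continuous_on[OF z'])

private lemma first_partials:
  shows "C1_surface_on (strip I) Z"
    and "\<And>u. u \<in> strip I \<Longrightarrow> pderiv_on (strip I) 1 Z u = helical_field \<phi> (\<lambda>_. 1) (\<lambda>_. 0) z' 0 u"
    and "\<And>u. u \<in> strip I \<Longrightarrow>
           pderiv_on (strip I) 2 Z u = helical_field \<phi> (\<lambda>s. - \<phi> * 0) (\<lambda>s. \<phi> * s) (\<lambda>_. c) 0 u"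
  by (rule helical_field_partials[where X = Z, OF perfect DERIV_ident DERIV_const z
        continuous_on_const continuous_on_const z'_continuous
        fun_cong[OF helicoidal_i_helical_field]]; assumption)+

private lemma second_partials_1:
  shows "C1_surface_on (strip I) (pderiv_on (strip I) 1 Z)"
    and "\<And>u. u \<in> strip I \<Longrightarrow> pderiv_on (strip I) 1 (pderiv_on (strip I) 1 Z) u =
           helical_field \<phi> (\<lambda>_. 0) (\<lambda>_. 0) z'' 0 u"
  by (rule helical_field_partials(1,2)[OF perfect DERIV_const DERIV_const z'
        continuous_on_const continuous_on_const z'' first_partials(2)]; assumption)+

private lemma second_partials_2:
  shows "C1_surface_on (strip I) (pderiv_on (strip I) 2 Z)"
    and "u \<in> strip I \<Longrightarrow> pderiv_on (strip I) 2 (pderiv_on (strip I) 2 Z) u =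
      helical_field \<phi> (\<lambda>s. - \<phi> * (\<phi> * s)) (\<lambda>s. \<phi> * (- \<phi> * 0)) (\<lambda>_. 0) 0 u"
  by (rule helical_field_partials(1,3)[where p' = "\<lambda>_. 0" and q' = "\<lambda>_. \<phi>" and r' = "\<lambda>_. 0",
        OF perfect _ _ _ _ _ _ first_partials(3)];
      auto intro!: derivative_eq_intros)+

private lemma minor_12:
  assumes "u \<in> strip I"
  shows "minorX (strip I) Z 1 2 u = \<phi> * u $ 1"
proof -
  let ?C = "cos (u $ 2 * \<phi>)" and ?S = "sin (u $ 2 * \<phi>)"
  have "minorX (strip I) Z 1 2 u = \<phi> * u $ 1 * (?C * ?C + ?S * ?S)"
    unfolding minorX_def first_partials(2,3)[OF assms] helical_field_def
    by (simp add: algebra_simps del: sin_cos_squared_add3)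
  then show ?thesis by simp
qed

lemma admissible_surface_helicoidal_i: "admissible_surface (strip I) Z"
proof -
  have "C1_surface_on (strip I) (pderiv_on (strip I) k Z)" for k
    using exhaust_2[of k] second_partials_1(1) second_partials_2(1) by auto
  moreover have "minorX (strip I) Z 1 2 u \<noteq> 0" if "u \<in> strip I" for u
    using minor_12[OF that] rotation positive that by (auto simp: strip_def)
  ultimately show ?thesis
    using first_partials(1) by (simp add: admissible_surface_def C2_surface_on_def)
qed

lemma mean_curvature_helicoidal_i:
  assumes "s \<in> I"
  shows "mean_curvature (strip I) Z (vector [s, t]) = (z'' s + z' s / s) / 2"
proof -
  define u :: "real^2" where "u = vector [s, t]"
  have u: "u \<in> strip I" "u $ 1 = s" "u $ 2 = t"
    using assms by (auto simp: u_def strip_def)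
  have "s \<noteq> 0" using assms positive by auto
  let ?C = "cos (t * \<phi>)" and ?S = "sin (t * \<phi>)"
  have trig: "?C * ?C + ?S * ?S = 1"
    using sin_cos_squared_add3 .
  have "fundI (strip I) Z 1 1 u = 1"
    using trig unfolding fundI_def iso_inner_def first_partials(2)[OF u(1)] helical_field_def
    by (simp add: u)
  moreover have "fundI (strip I) Z 1 2 u = 0"
    unfolding fundI_def iso_inner_def first_partials(2,3)[OF u(1)] helical_field_def
    by (simp add: u)
  moreover have "fundI (strip I) Z 2 2 u = \<phi>\<^sup>2 * s\<^sup>2"
  proof -
    have "fundI (strip I) Z 2 2 u = \<phi>\<^sup>2 * s\<^sup>2 * (?C * ?C + ?S * ?S)"
      unfolding fundI_def iso_inner_def first_partials(3)[OF u(1)] helical_field_def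
      by (simp add: u power2_eq_square algebra_simps del: sin_cos_squared_add3)
    then show ?thesis by (simp only: trig mult_1_right)
  qed
  moreover have "fundII (strip I) Z 1 1 u = z'' s"
    unfolding fundII_def second_partials_1(2)[OF u(1)] minimal_normal_def helical_field_def
    by (simp add: u inner_vec_def sum_3)
  moreover have "fundII (strip I) Z 2 2 u = \<phi>\<^sup>2 * s * z' s"
  proof -
    have "fundII (strip I) Z 2 2 u
        = - \<phi>\<^sup>2 * s * (minorX (strip I) Z 2 3 u * ?C + minorX (strip I) Z 3 1 u * ?S) / (\<phi> * s)"
      unfolding fundII_def second_partials_2(2)[OF u(1)] minimal_normal_def helical_field_def
      using \<open>s \<noteq> 0\<close> rotation
      by (simp add: u inner_vec_def sum_3 minor_12[OF u(1)] field_simps power2_eq_square)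
    \<comment> \<open>The contributions of the pitch \<open>c\<close> to the two minors cancel in this combination.\<close>
    also have "minorX (strip I) Z 2 3 u * ?C + minorX (strip I) Z 3 1 u * ?S
        = - z' s * \<phi> * s * (?C * ?C + ?S * ?S)"
      unfolding minorX_def first_partials(2,3)[OF u(1)] helical_field_def
      by (simp add: u algebra_simps del: sin_cos_squared_add3)
    also have "- \<phi>\<^sup>2 * s * (- z' s * \<phi> * s * (?C * ?C + ?S * ?S)) / (\<phi> * s) = \<phi>\<^sup>2 * s * z' s"
      unfolding trig using \<open>s \<noteq> 0\<close> rotation by simp
    finally show ?thesis .
  qed
  ultimately have "mean_curvature (strip I) Z u
      = (1 / 2) * ((\<phi>\<^sup>2 * s * z' s + \<phi>\<^sup>2 * s\<^sup>2 * z'' s) / (\<phi>\<^sup>2 * s\<^sup>2))"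
    unfolding mean_curvature_def by simp
  also have "\<dots> = (z'' s + z' s / s) / 2"
    using \<open>s \<noteq> 0\<close> rotation by (simp add: field_simps power2_eq_square)
  finally show ?thesis by (simp add: u_def)
qed

end

section \<open>Generating curves with prescribed mean curvature\<close>

lemma generating_curve_derivative:
  assumes "(z has_real_derivative z') (at s within I)"
  shows "(generating_curve (\<lambda>s. s) z has_vector_derivative vector [1, 0, z']) (at s within I)"
  unfolding generating_curve_def
  using assms by (intro has_vector_derivative_vector_3 DERIV_ident DERIV_const)

lemma C2_curve_on_generating_curve:
  assumes "\<And>s. s \<in> I \<Longrightarrow> (z has_real_derivative z' s) (at s within I)"
    and "\<And>s. s \<in> I \<Longrightarrow> (z' has_real_derivative z'' s) (at s within I)"
    and "continuous_on I z''"
  shows "C2_curve_on I (generating_curve (\<lambda>s. s) z)"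
  unfolding C2_curve_on_def
  using assms
  by (intro exI[of _ "\<lambda>s. vector [1, 0, z' s]"] exI[of _ "\<lambda>s. vector [0, 0, z'' s]"] conjI ballI
      generating_curve_derivative has_vector_derivative_vector_3 DERIV_const
      continuous_on_vector_3 continuous_on_const)

lemma iso_arclength_on_generating_curve:
  assumes "\<And>s. s \<in> I \<Longrightarrow> s islimpt I"
    and "\<And>s. s \<in> I \<Longrightarrow> (z has_real_derivative z' s) (at s within I)"
  shows "iso_arclength_on I (generating_curve (\<lambda>s. s) z)"
proof -
  have "vector_derivative (generating_curve (\<lambda>s. s) z) (at s within I) = vector [1, 0, z' s]"
    if "s \<in> I" for s
    using assms that
    by (intro vector_derivative_within generating_curve_derivative) (auto simp: trivial_limit_within)
  then show ?thesis by (simp add: iso_arclength_on_def iso_inner_def)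
qed

theorem theorem5p4:
  fixes c \<phi> s0 :: real and I :: "real set" and H :: "real \<Rightarrow> real"
  assumes "\<phi> \<noteq> 0"
    and "is_interval I" and "interior I \<noteq> {}" and "I \<subseteq> {0<..}" and "s0 \<in> I"
    and "continuous_on I H"
  shows "\<exists>z :: real \<Rightarrow> real \<Rightarrow> real \<Rightarrow> real. \<forall>h0 h1.
     C2_curve_on I (generating_curve (\<lambda>s. s) (z h0 h1)) \<and>
     iso_arclength_on I (generating_curve (\<lambda>s. s) (z h0 h1)) \<and>
     admissible_surface (strip I) (helicoidal_i c \<phi> (\<lambda>s. s) (z h0 h1)) \<and>
     (\<forall>s\<in>I. \<forall>t. mean_curvature (strip I) (helicoidal_i c \<phi> (\<lambda>s. s) (z h0 h1)) (vector [s, t]) = H s) \<and>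
     (\<forall>s\<in>I. z h0 h1 s = h0 + h1 * ln s +
        (LBINT v=ereal s0..ereal s. (2 / v) * (LBINT w=ereal s0..ereal v. w * H w))) \<and>
     h1 = s0 * vector_derivative (z h0 h1) (at s0 within I) \<and>
     h0 = z h0 h1 s0 - s0 * vector_derivative (z h0 h1) (at s0 within I) * ln s0"
proof -
  have pos: "s > 0" if "s \<in> I" for s
    using assms(4) that by auto
  note perfect = interval_limit_point[OF assms(2,3)]
  define P where "P v = (LBINT w=ereal s0..ereal v. w * H w)" for v
  define Q where "Q s = (LBINT v=ereal s0..ereal s. (2 / v) * P v)" for s
  have P: "(P has_real_derivative s * H s) (at s within I)" if "s \<in> I" for s
    unfolding P_def
    by (intro interval_integral_has_derivative_within[OF assms(2,5)] continuous_intros assms(6) that)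
  have contP: "continuous_on I P"
    by (rule DERIV_continuous_on[OF P])
  have Q: "(Q has_real_derivative (2 / s) * P s) (at s within I)" if "s \<in> I" for s
    unfolding Q_def
    by (intro interval_integral_has_derivative_within[OF assms(2,5)] continuous_intros contP that)
      (use pos in force)
  have base: "P s0 = 0" "Q s0 = 0"
    by (simp_all add: P_def Q_def)
  define z where "z h0 h1 s = h0 + h1 * ln s + Q s" for h0 h1 s
  define z' where "z' h1 s = (h1 + 2 * P s) / s" for h1 s
  \<comment> \<open>This is \<open>2H - z'/s\<close> in expanded form.\<close>
  define z'' where "z'' h1 s = 2 * H s - (h1 + 2 * P s) / s\<^sup>2" for h1 s
  have z: "(z h0 h1 has_real_derivative z' h1 s) (at s within I)" if "s \<in> I" for h0 h1 s
    unfolding z_def z'_def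
    using pos[OF that]
    by (auto intro!: derivative_eq_intros Q that simp: field_simps)
  have z': "(z' h1 has_real_derivative z'' h1 s) (at s within I)" if "s \<in> I" for h1 s
    unfolding z'_def z''_def using pos[OF that]
    by (auto intro!: derivative_eq_intros P that simp: field_simps power2_eq_square)
  have z'': "continuous_on I (z'' h1)" for h1
    unfolding z''_def using pos by (intro continuous_intros contP assms(6)) force
  have "mean_curvature (strip I) (helicoidal_i c \<phi> (\<lambda>s. s) (z h0 h1)) (vector [s, t]) = H s"
    if "s \<in> I" for h0 h1 s t
  proof -
    have "mean_curvature (strip I) (helicoidal_i c \<phi> (\<lambda>s. s) (z h0 h1)) (vector [s, t])
        = (z'' h1 s + z' h1 s / s) / 2"
      by (rule mean_curvature_helicoidal_i[OF perfect assms(4,1) z z' z'' that])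
    also have "\<dots> = H s"
      using pos[OF that] by (simp add: z'_def z''_def field_simps power2_eq_square)
    finally show ?thesis .
  qed
  moreover have "vector_derivative (z h0 h1) (at s0 within I) = h1 / s0" for h0 h1
    using vector_derivative_within[of s0 I "z h0 h1" "z' h1 s0"] z[of s0] assms(5) perfect[of s0] base
    by (simp add: z'_def has_real_derivative_iff_has_vector_derivative trivial_limit_within)
  ultimately show ?thesis
    using pos[OF assms(5)] base
    by (intro exI[of _ z] allI conjI ballI C2_curve_on_generating_curve[OF z z' z'']
        iso_arclength_on_generating_curve[OF perfect z]
        admissible_surface_helicoidal_i[OF perfect assms(4,1) z z' z''])
      (auto simp: z_def Q_def P_def)
qed

end
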